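(* Let $\theta\in[0,2\pi)$, $x\in\mathbb R$, $\eta>0$, $E\ge0$, and let $w^E_{\theta,x,\eta}:=\inf_{\hat\tau\in\mathcal S_0^E}\operatorname{Tr}(\hat\tau\,\hat W_{\theta,x,\eta})$. Suppose the measured state $\hat\sigma$ belongs to $\mathcal S_0^E$, let $q_1,\dots,q_M$ ($M\ge1$) be the i.i.d. outcomes of measuring $\hat q_\theta$ on $M$ copies of $\hat\sigma$, and let $$\bar w_{\hat\sigma}=\frac1M\sum_{j=1}^M\mathbf 1_{[x-\frac\eta2,\,x+\frac\eta2]}(q_j).$$ Then for every fixed $\epsilon>0$, $$p_{\mathrm{fail}}:=\Pr\left(\bar w_{\hat\sigma}<w^E_{\theta,x,\eta}-\epsilon\right)\le\exp(-2M\epsilon^2).$$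
   Context: Setting: $\mathcal H=L^2(\mathbb R)$ (one bosonic mode), with position and momentum operators $\hat x,\hat p$ satisfying $[\hat x,\hat p]=i$, annihilation operator $\hat a=(\hat x+i\hat p)/\sqrt2$, number operator $\hat n=\hat a^\dagger\hat a$, and Fock basis $\{|n\rangle\}_{n\ge0}$ of eigenvectors of $\hat n$. States are density operators on $\mathcal H$; a pure state is identified with its rank-one projector $|\psi\rangle\langle\psi|$. For $\theta\in[0,2\pi)$ the quadrature operator is $\hat q_\theta=e^{-i\theta\hat n}\hat x e^{i\theta\hat n}=\hat x\cos\theta+\hat p\sin\theta$, with generalized eigenvectors $|q\rangle_{\hat q_\theta}$, $q\in\mathbb R$. Measuring $\hat q_\theta$ on a state $\hat\sigma$ yields a real random variable whose law is $A\mapsto\operatorname{Tr}(\hat\sigma\,\mathbf 1_A(\hat q_\theta))$. Witness: for $x\in\mathbb R$, $\eta>0$, $\hat W_{\theta,x,\eta}=\int_{x-\eta/2}^{x+\eta/2}|q\rangle\langle q|_{\hat q_\theta}\,dq$, i.e. the spectral projector of the self-adjoint operator $\hat q_\theta$ for the interval $[x-\eta/2,x+\eta/2]$. Stellar rank: for a pure state $|\psi\rangle=\sum_n\psi_n|n\rangle$, $r^\star(\psi)\in\mathbb N_0\cup\{\infty\}$ is the number of zeros in $\mathbb C$, counted with multiplicity, of the entire function $F^\star_\psi(\alpha)=\sum_n\psi_n\alpha^n/\sqrt{n!}$. A pure state has stellar rank $0$ if and only if it is Gaussian, i.e. of the form $\hat D(\alpha)\hat S(\chi)|0\rangle$ with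 $\alpha,\chi\in\mathbb C$, where $\hat D(\alpha)=e^{\alpha\hat a^\dagger-\alpha^*\hat a}$ and $\hat S(\chi)=e^{\frac12(\chi^*\hat a^2-\chi\hat a^{\dagger2})}$. Energy-bounded sets: for a set $S$ of states, $\mathrm{cch}(S)$ is its closed convex hull in trace norm. For $E\ge0$ and $r\in\mathbb N_0$, $\mathcal S_r^E=\mathrm{cch}\{|\psi\rangle\langle\psi| : \|\psi\|=1,\ \langle\psi|\hat n|\psi\rangle\le E,\ r^\star(\psi)\le r\}$. In particular $\mathcal S_0^E$ is the set of mixtures of pure Gaussian states of energy at most $E$. *)

theory Defs
  imports "HOL-Probability.Probability" "HOL-Complex_Analysis.Complex_Analysis"
begin

definition square_integrable :: "(real \<Rightarrow> complex) \<Rightarrow> bool" where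
  "square_integrable f \<longleftrightarrow>
     f \<in> borel_measurable borel \<and> integrable lborel (\<lambda>x. (cmod (f x))\<^sup>2)"

definition L2_rel :: "(real \<Rightarrow> complex) \<Rightarrow> (real \<Rightarrow> complex) \<Rightarrow> bool" where
  "L2_rel f g \<longleftrightarrow> square_integrable f \<and> square_integrable g \<and> (AE x in lborel. f x = g x)"

lemma borel_measurable_cnj [measurable]: "cnj \<in> borel_measurable borel"
  by (intro borel_measurable_continuous_onI continuous_intros)

lemma square_integrable_zero: "square_integrable (\<lambda>x. 0)"
  by (simp add: square_integrable_def)

lemma square_integrable_add:
  assumes "square_integrable f" "square_integrable g"
  shows "square_integrable (\<lambda>x. f x + g x)"
proof -
  have [measurable]: "f \<in> borel_measurable borel" "g \<in> borel_measurable borel"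
    using assms by (auto simp: square_integrable_def)
  have i: "integrable lborel (\<lambda>x. 2 * (cmod (f x))\<^sup>2 + 2 * (cmod (g x))\<^sup>2)"
    using assms by (auto simp: square_integrable_def)
  have "(cmod (f x + g x))\<^sup>2 \<le> 2 * (cmod (f x))\<^sup>2 + 2 * (cmod (g x))\<^sup>2" for x
  proof -
    have "(cmod (f x + g x))\<^sup>2 \<le> (cmod (f x) + cmod (g x))\<^sup>2"
      by (intro power_mono norm_triangle_ineq) auto
    also have "\<dots> \<le> 2 * (cmod (f x))\<^sup>2 + 2 * (cmod (g x))\<^sup>2"
      using sum_squares_bound[of "cmod (f x)" "cmod (g x)"] by (simp add: power2_sum)
    finally show ?thesis .
  qed
  then have "integrable lborel (\<lambda>x. (cmod (f x + g x))\<^sup>2)"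
    by (intro Bochner_Integration.integrable_bound[OF i] always_eventually allI) auto
  then show ?thesis using assms by (simp add: square_integrable_def)
qed

lemma square_integrable_cmult:
  assumes "square_integrable f"
  shows "square_integrable (\<lambda>x. c * f x)"
  using assms by (auto simp: square_integrable_def norm_mult power_mult_distrib)

lemma square_integrable_cmult_right:
  assumes "square_integrable f"
  shows "square_integrable (\<lambda>x. f x * c)"
  using square_integrable_cmult[OF assms, of c] by (simp add: mult.commute)

lemma integrable_cnj_mult:
  assumes "square_integrable f" "square_integrable g"
  shows "integrable lborel (\<lambda>x. cnj (f x) * g x)"
proof -
  have [measurable]: "f \<in> borel_measurable borel" "g \<in> borel_measurable borel"
    using assms by (auto simp: square_integrable_def)
  have i: "integrable lborel (\<lambda>x. (cmod (f x))\<^sup>2 + (cmod (g x))\<^sup>2)"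
    using assms by (auto simp: square_integrable_def)
  have "norm (cnj (f x) * g x) \<le> norm ((cmod (f x))\<^sup>2 + (cmod (g x))\<^sup>2)" for x
  proof -
    have "0 \<le> cmod (f x) * cmod (g x)" by simp
    moreover have "2 * (cmod (f x) * cmod (g x)) \<le> (cmod (f x))\<^sup>2 + (cmod (g x))\<^sup>2"
      using sum_squares_bound[of "cmod (f x)" "cmod (g x)"] by simp
    ultimately have "cmod (f x) * cmod (g x) \<le> (cmod (f x))\<^sup>2 + (cmod (g x))\<^sup>2"
      by linarith
    then show ?thesis by (simp add: norm_mult)
  qed
  then show ?thesis
    by (intro Bochner_Integration.integrable_bound[OF i] always_eventually allI) auto
qed

quotient_type L2 = "real \<Rightarrow> complex" / partial: L2_rel
proof (rule part_equivpI)
  show "\<exists>f. L2_rel f f"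
    using square_integrable_zero by (auto simp: L2_rel_def)
  show "symp L2_rel"
    by (auto simp: symp_def L2_rel_def eq_commute)
  show "transp L2_rel"
    by (auto simp: transp_def L2_rel_def elim: AE_mp)
qed

lift_definition cscale :: "complex \<Rightarrow> L2 \<Rightarrow> L2"  (infixr \<open>*\<^sub>C\<close> 75)
  is "\<lambda>c f x. c * f x"
  by (auto simp: L2_rel_def intro: square_integrable_cmult)

lift_definition cinner :: "L2 \<Rightarrow> L2 \<Rightarrow> complex"
  is "\<lambda>f g. \<integral>x. cnj (f x) * g x \<partial>lborel"
proof -
  fix f f' g g' assume *: "L2_rel f f'" "L2_rel g g'"
  then have [measurable]: "f \<in> borel_measurable borel" "f' \<in> borel_measurable borel"
     "g \<in> borel_measurable borel" "g' \<in> borel_measurable borel"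
    by (auto simp: L2_rel_def square_integrable_def)
  have "AE x in lborel. f x = f' x" "AE x in lborel. g x = g' x"
    using * by (auto simp: L2_rel_def)
  then have "AE x in lborel. cnj (f x) * g x = cnj (f' x) * g' x"
    by eventually_elim simp
  then show "(\<integral>x. cnj (f x) * g x \<partial>lborel) = (\<integral>x. cnj (f' x) * g' x \<partial>lborel)"
    by (intro integral_cong_AE) auto
qed

instantiation L2 :: real_vector
begin

lift_definition zero_L2 :: L2 is "\<lambda>x. 0"
  by (auto simp: L2_rel_def square_integrable_zero)

lift_definition plus_L2 :: "L2 \<Rightarrow> L2 \<Rightarrow> L2" is "\<lambda>f g x. f x + g x"
  by (auto simp: L2_rel_def intro: square_integrable_add)

definition uminus_L2 :: "L2 \<Rightarrow> L2" where "uminus_L2 \<psi> = (- 1) *\<^sub>C \<psi>"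

definition minus_L2 :: "L2 \<Rightarrow> L2 \<Rightarrow> L2" where "minus_L2 \<psi> \<phi> = \<psi> + (- \<phi> :: L2)"

definition scaleR_L2 :: "real \<Rightarrow> L2 \<Rightarrow> L2" where "scaleR_L2 r \<psi> = complex_of_real r *\<^sub>C \<psi>"

instance
proof
  fix a b c :: L2 and r s :: real
  show "a + b + c = a + (b + c)"
    by transfer (auto simp: L2_rel_def algebra_simps intro!: square_integrable_add)
  show "a + b = b + a"
    by transfer (auto simp: L2_rel_def algebra_simps intro!: square_integrable_add)
  show "0 + a = a"
    by transfer (auto simp: L2_rel_def)
  show "- a + a = 0"
    unfolding uminus_L2_def by transfer (auto simp: L2_rel_def square_integrable_zero)
  show "a - b = a + - b"
    by (simp add: minus_L2_def)
  show "r *\<^sub>R (a + b) = r *\<^sub>R a + r *\<^sub>R b"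
    unfolding scaleR_L2_def
    by transfer (auto simp: L2_rel_def algebra_simps
        intro!: square_integrable_add square_integrable_cmult square_integrable_cmult_right)
  show "(r + s) *\<^sub>R a = r *\<^sub>R a + s *\<^sub>R a"
    unfolding scaleR_L2_def
    by transfer (auto simp: L2_rel_def algebra_simps
        intro!: square_integrable_add square_integrable_cmult square_integrable_cmult_right)
  show "r *\<^sub>R s *\<^sub>R a = (r * s) *\<^sub>R a"
    unfolding scaleR_L2_def
    by transfer (auto simp: L2_rel_def mult.assoc simp flip: mult.assoc
        intro!: square_integrable_cmult)
  show "1 *\<^sub>R a = a"
    unfolding scaleR_L2_def by transfer (auto simp: L2_rel_def)
qed

end

lemma cinner_commute: "cinner \<phi> \<psi> = cnj (cinner \<psi> \<phi>)"
proof transfer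
  fix f g :: "real \<Rightarrow> complex"
  have "(\<integral>x. cnj (g x) * f x \<partial>lborel) = (\<integral>x. cnj (cnj (f x) * g x) \<partial>lborel)"
    by (simp add: mult.commute)
  then show "(\<integral>x. cnj (g x) * f x \<partial>lborel) = cnj (\<integral>x. cnj (f x) * g x \<partial>lborel)"
    by (simp only: Bochner_Integration.integral_cnj)
qed

lemma cinner_add_right: "cinner \<phi> (\<psi> + \<xi>) = cinner \<phi> \<psi> + cinner \<phi> \<xi>"
proof transfer
  fix f g h assume "L2_rel f f" "L2_rel g g" "L2_rel h h"
  then have "integrable lborel (\<lambda>x. cnj (f x) * g x)" "integrable lborel (\<lambda>x. cnj (f x) * h x)"
    by (auto simp: L2_rel_def intro: integrable_cnj_mult)
  then show "(\<integral>x. cnj (f x) * (g x + h x) \<partial>lborel) =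
      (\<integral>x. cnj (f x) * g x \<partial>lborel) + (\<integral>x. cnj (f x) * h x \<partial>lborel)"
    by (simp add: distrib_left)
qed

lemma cinner_cscale_right: "cinner \<phi> (c *\<^sub>C \<psi>) = c * cinner \<phi> \<psi>"
  by transfer (simp add: mult.left_commute)

lemma cinner_self: "cinner \<psi> \<psi> = complex_of_real (Re (cinner \<psi> \<psi>))"
  using cinner_commute[of \<psi> \<psi>] by (metis Reals_cnj_iff of_real_Re)

lemma Re_cinner_self_ge_0: "0 \<le> Re (cinner \<psi> \<psi>)"
proof transfer
  fix f assume "L2_rel f f"
  have "(\<integral>x. cnj (f x) * f x \<partial>lborel) = (\<integral>x. complex_of_real ((cmod (f x))\<^sup>2) \<partial>lborel)"
    by (intro Bochner_Integration.integral_cong refl)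
      (simp add: complex_norm_square mult.commute del: of_real_power)
  also have "\<dots> = complex_of_real (\<integral>x. (cmod (f x))\<^sup>2 \<partial>lborel)"
    by (rule integral_complex_of_real)
  finally show "0 \<le> Re (\<integral>x. cnj (f x) * f x \<partial>lborel)" by simp
qed

lemma Re_cinner_self_eq_0_iff: "Re (cinner \<psi> \<psi>) = 0 \<longleftrightarrow> \<psi> = 0"
proof transfer
  fix f assume f: "L2_rel f f"
  then have i: "integrable lborel (\<lambda>x. (cmod (f x))\<^sup>2)"
    by (simp add: L2_rel_def square_integrable_def)
  have "(\<integral>x. cnj (f x) * f x \<partial>lborel) = (\<integral>x. complex_of_real ((cmod (f x))\<^sup>2) \<partial>lborel)"
    by (intro Bochner_Integration.integral_cong refl)
      (simp add: complex_norm_square mult.commute del: of_real_power)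
  also have "\<dots> = complex_of_real (\<integral>x. (cmod (f x))\<^sup>2 \<partial>lborel)"
    by (rule integral_complex_of_real)
  finally have "Re (\<integral>x. cnj (f x) * f x \<partial>lborel) = (\<integral>x. (cmod (f x))\<^sup>2 \<partial>lborel)" by simp
  moreover have "(\<integral>x. (cmod (f x))\<^sup>2 \<partial>lborel) = 0 \<longleftrightarrow> (AE x in lborel. (cmod (f x))\<^sup>2 = 0)"
    using i by (intro integral_nonneg_eq_0_iff_AE) auto
  ultimately show "Re (\<integral>x. cnj (f x) * f x \<partial>lborel) = 0 \<longleftrightarrow> L2_rel f (\<lambda>x. 0)"
    using f by (auto simp: L2_rel_def square_integrable_zero)
qed

instantiation L2 :: real_inner
begin

definition inner_L2 :: "L2 \<Rightarrow> L2 \<Rightarrow> real" where "inner_L2 \<phi> \<psi> = Re (cinner \<phi> \<psi>)"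

definition norm_L2 :: "L2 \<Rightarrow> real" where "norm_L2 \<psi> = sqrt (\<psi> \<bullet> \<psi>)"

definition sgn_L2 :: "L2 \<Rightarrow> L2" where "sgn_L2 \<psi> = \<psi> /\<^sub>R norm \<psi>"

definition dist_L2 :: "L2 \<Rightarrow> L2 \<Rightarrow> real" where "dist_L2 \<phi> \<psi> = norm (\<phi> - \<psi>)"

definition uniformity_L2 :: "(L2 \<times> L2) filter" where
  "uniformity_L2 = (INF e\<in>{0<..}. principal {(\<phi>, \<psi>). dist \<phi> \<psi> < e})"

definition open_L2 :: "L2 set \<Rightarrow> bool" where
  "open_L2 U \<longleftrightarrow> (\<forall>\<psi>\<in>U. eventually (\<lambda>(\<psi>', \<phi>). \<psi>' = \<psi> \<longrightarrow> \<phi> \<in> U) uniformity)"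

instance
proof
  fix x y z :: L2 and r :: real
  show "dist x y = norm (x - y)" by (rule dist_L2_def)
  show "sgn x = x /\<^sub>R norm x" by (rule sgn_L2_def)
  show "uniformity = (INF e\<in>{0<..}. principal {(x, y :: L2). dist x y < e})"
    by (rule uniformity_L2_def)
  show "open U \<longleftrightarrow> (\<forall>x\<in>U. eventually (\<lambda>(x', y). x' = x \<longrightarrow> y \<in> U) uniformity)" for U :: "L2 set"
    by (rule open_L2_def)
  show "x \<bullet> y = y \<bullet> x"
    unfolding inner_L2_def by (subst cinner_commute) simp
  then have comm: "x \<bullet> y = y \<bullet> x" for x y :: L2
    unfolding inner_L2_def by (subst cinner_commute) simp
  have "z \<bullet> (x + y) = z \<bullet> x + z \<bullet> y"
    by (simp add: inner_L2_def cinner_add_right)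
  then show "(x + y) \<bullet> z = x \<bullet> z + y \<bullet> z" by (simp add: comm)
  have "y \<bullet> (r *\<^sub>R x) = r * (y \<bullet> x)"
    by (simp add: inner_L2_def scaleR_L2_def cinner_cscale_right)
  then show "(r *\<^sub>R x) \<bullet> y = r * (x \<bullet> y)" by (simp add: comm)
  show "0 \<le> x \<bullet> x" by (simp add: inner_L2_def Re_cinner_self_ge_0)
  show "x \<bullet> x = 0 \<longleftrightarrow> x = 0" by (simp add: inner_L2_def Re_cinner_self_eq_0_iff)
  show "norm x = sqrt (x \<bullet> x)" by (rule norm_L2_def)
qed

end

lemma cscale_scaleR: "c *\<^sub>C (r *\<^sub>R \<psi>) = r *\<^sub>R (c *\<^sub>C \<psi>)"
  unfolding scaleR_L2_def
  by transfer (auto simp: L2_rel_def mult.left_commute intro!: square_integrable_cmult)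

lemma cscale_add_left: "(c + d) *\<^sub>C \<psi> = c *\<^sub>C \<psi> + d *\<^sub>C \<psi>"
  by transfer (auto simp: L2_rel_def algebra_simps
      intro!: square_integrable_cmult square_integrable_add)

lemma cscale_cscale: "c *\<^sub>C d *\<^sub>C \<psi> = (c * d) *\<^sub>C \<psi>"
  by transfer (auto simp: L2_rel_def mult.assoc simp flip: mult.assoc
      intro!: square_integrable_cmult)

lemma norm_cscale: "norm (c *\<^sub>C \<psi>) = cmod c * norm \<psi>"
proof -
  have "cinner (c *\<^sub>C \<psi>) (c *\<^sub>C \<psi>) = (c * cnj c) * cinner \<psi> \<psi>"
    by (simp add: cinner_cscale_right cinner_commute[of "c *\<^sub>C \<psi>"] flip: cinner_commute[of \<psi> \<psi>])
  also have "\<dots> = complex_of_real ((cmod c)\<^sup>2 * Re (cinner \<psi> \<psi>))"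
    by (subst cinner_self) (simp flip: complex_norm_square)
  finally show ?thesis
    by (simp add: norm_L2_def inner_L2_def real_sqrt_mult)
qed

lemma norm_cinner_le: "cmod (cinner \<phi> \<psi>) \<le> norm \<phi> * norm \<psi>"
proof -
  obtain u where u: "cmod u = 1" "u * cinner \<phi> \<psi> = complex_of_real (cmod (cinner \<phi> \<psi>))"
  proof (cases "cinner \<phi> \<psi> = 0")
    case True
    then show ?thesis using that[of 1] by simp
  next
    case False
    then have "cnj (sgn (cinner \<phi> \<psi>)) * cinner \<phi> \<psi> = complex_of_real (cmod (cinner \<phi> \<psi>))"
      by (simp add: sgn_eq field_simps complex_norm_square[symmetric] power2_eq_square)
    with False show ?thesis using that[of "cnj (sgn (cinner \<phi> \<psi>))"] by (simp add: norm_sgn)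
  qed
  have "cmod (cinner \<phi> \<psi>) = \<phi> \<bullet> (u *\<^sub>C \<psi>)"
    by (simp add: inner_L2_def cinner_cscale_right u)
  also have "\<dots> \<le> norm \<phi> * norm (u *\<^sub>C \<psi>)" by (rule norm_cauchy_schwarz)
  finally show ?thesis by (simp add: norm_cscale u)
qed

text \<open>
  Wave functions of the Fock states in the position representation, generated from the vacuum by
  \<open>|n+1\<rangle> = a\<^sup>\<dagger>|n\<rangle> / \<surd>(n+1)\<close>, where \<open>a\<^sup>\<dagger> = (x - ip)/\<surd>2\<close> acts as \<open>(x - d/dx)/\<surd>2\<close>.
\<close>

fun fock_fun :: "nat \<Rightarrow> real \<Rightarrow> real" where
  "fock_fun 0 x = pi powr (- 1/4) * exp (- x\<^sup>2 / 2)"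
| "fock_fun (Suc n) x =
     (x * fock_fun n x - deriv (fock_fun n) x) / (sqrt 2 * sqrt (real (Suc n)))"

lemma fock_fun_poly: "\<exists>p :: real poly. fock_fun n = (\<lambda>x. poly p x * exp (- x\<^sup>2 / 2))"
proof (induction n)
  case 0
  have "fock_fun 0 = (\<lambda>x. poly [:pi powr (- 1/4):] x * exp (- x\<^sup>2 / 2))"
    by auto
  then show ?case by blast
next
  case (Suc n)
  then obtain p :: "real poly" where p: "fock_fun n = (\<lambda>x. poly p x * exp (- x\<^sup>2 / 2))" by blast
  have "((\<lambda>x. poly p x * exp (- x\<^sup>2 / 2)) has_real_derivative
        (poly (pderiv p) x * exp (- x\<^sup>2 / 2) + poly p x * (exp (- x\<^sup>2 / 2) * (- x)))) (at x)" for x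
    by (auto intro!: derivative_eq_intros poly_DERIV)
  then have d: "deriv (fock_fun n) x =
      poly (pderiv p) x * exp (- x\<^sup>2 / 2) + poly p x * (exp (- x\<^sup>2 / 2) * (- x))" for x
    unfolding p by (rule DERIV_imp_deriv)
  define q where "q = smult (1 / (sqrt 2 * sqrt (real (Suc n)))) ([:0, 2:] * p - pderiv p)"
  have "fock_fun (Suc n) x = poly q x * exp (- x\<^sup>2 / 2)" for x
    unfolding fock_fun.simps(2) d q_def unfolding p
    by (simp add: field_simps del: of_nat_Suc)
  then show ?case by blast
qed

lemma integrable_poly_gauss: "integrable lborel (\<lambda>x. poly p x * exp (- x\<^sup>2 / 2) :: real)"
proof -
  have "integrable lborel (\<lambda>x. sqrt (2 * pi) * (std_normal_density x * x ^ k))" for k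
    by (intro integrable_mult_right integrable_std_normal_moment)
  then have *: "integrable lborel (\<lambda>x. x ^ k * exp (- x\<^sup>2 / 2) :: real)" for k
    by (simp add: std_normal_density_def mult.commute)
  show ?thesis
    unfolding poly_altdef sum_distrib_right mult.assoc
    by (intro Bochner_Integration.integrable_sum integrable_mult_right *)
qed

lift_definition fock :: "nat \<Rightarrow> L2" is "\<lambda>n x. complex_of_real (fock_fun n x)"
proof -
  fix n
  obtain p :: "real poly" where p: "fock_fun n = (\<lambda>x. poly p x * exp (- x\<^sup>2 / 2))"
    using fock_fun_poly by blast
  have meas: "fock_fun n \<in> borel_measurable borel"
    unfolding p by (auto intro!: borel_measurable_continuous_onI continuous_intros)
  have "integrable lborel (\<lambda>x. (fock_fun n x)\<^sup>2)"
  proof (rule Bochner_Integration.integrable_bound)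
    show "integrable lborel (\<lambda>x. poly (p * p) x * exp (- x\<^sup>2 / 2))"
      by (rule integrable_poly_gauss)
    show "(\<lambda>x. (fock_fun n x)\<^sup>2) \<in> borel_measurable lborel"
      using meas by simp
    have "exp (- x\<^sup>2 / 2) * exp (- x\<^sup>2 / 2) \<le> exp (- x\<^sup>2 / 2) * (1::real)" for x :: real
      by (intro mult_left_mono) auto
    then have "(fock_fun n x)\<^sup>2 \<le> poly (p * p) x * exp (- x\<^sup>2 / 2)" for x
      using mult_left_mono[of "exp (- x\<^sup>2 / 2) * exp (- x\<^sup>2 / 2)" "exp (- x\<^sup>2 / 2)" "poly p x * poly p x"]
      by (simp add: p power2_eq_square algebra_simps)
    then show "AE x in lborel. norm ((fock_fun n x)\<^sup>2) \<le> norm (poly (p * p) x * exp (- x\<^sup>2 / 2))"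
      by (intro always_eventually allI) (auto simp: intro: order_trans[OF _ abs_ge_self])
  qed
  with meas show "L2_rel (\<lambda>x. complex_of_real (fock_fun n x)) (\<lambda>x. complex_of_real (fock_fun n x))"
    by (auto simp: L2_rel_def square_integrable_def)
qed

text \<open>
  The quadratic form \<open>\<langle>\<psi>|a\<^sup>\<dagger>a|\<psi>\<rangle>\<close>, with value \<open>\<infinity>\<close> outside the form domain of the number operator.
\<close>

definition energy :: "L2 \<Rightarrow> ennreal" where
  "energy \<psi> = (\<Sum>n. ennreal (real n * (cmod (cinner (fock n) \<psi>))\<^sup>2))"

definition stellar_fun :: "L2 \<Rightarrow> complex \<Rightarrow> complex" where
  "stellar_fun \<psi> \<alpha> = (\<Sum>n. cinner (fock n) \<psi> * \<alpha> ^ n / complex_of_real (sqrt (fact n)))"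

definition stellar_rank :: "L2 \<Rightarrow> enat" where
  "stellar_rank \<psi> =
     (if finite {\<alpha>. stellar_fun \<psi> \<alpha> = 0}
      then enat (\<Sum>\<alpha> | stellar_fun \<psi> \<alpha> = 0. nat (zorder (stellar_fun \<psi>) \<alpha>))
      else \<infinity>)"

text \<open>
  The type \<open>L2 \<Rightarrow>\<^sub>L L2\<close> contains the bounded real-linear operators; \<open>clinear\<close> singles out the
  complex-linear ones.
\<close>

definition clinear :: "(L2 \<Rightarrow> L2) \<Rightarrow> bool" where
  "clinear T \<longleftrightarrow> (\<forall>\<phi> \<psi>. T (\<phi> + \<psi>) = T \<phi> + T \<psi>) \<and> (\<forall>c \<psi>. T (c *\<^sub>C \<psi>) = c *\<^sub>C T \<psi>)"

definition op_trace :: "(L2 \<Rightarrow> L2) \<Rightarrow> complex" where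
  "op_trace T = (\<Sum>n. cinner (fock n) (T (fock n)))"

definition positive_op :: "(L2 \<Rightarrow> L2) \<Rightarrow> bool" where
  "positive_op T \<longleftrightarrow> clinear T \<and> (\<forall>\<psi>. cinner \<psi> (T \<psi>) \<in> \<real>\<^sub>\<ge>\<^sub>0)"

text \<open>
  The positive square root of \<open>T\<^sup>\<dagger>T\<close>. The constant \<open>adjoint\<close> refers to the real inner product
  \<open>Re \<langle>\<phi>|\<psi>\<rangle>\<close>; on complex-linear operators this is the same as the adjoint for \<open>\<langle>\<phi>|\<psi>\<rangle>\<close>.
\<close>

definition abs_op :: "(L2 \<Rightarrow>\<^sub>L L2) \<Rightarrow> (L2 \<Rightarrow>\<^sub>L L2)" where
  "abs_op T = (THE R. positive_op (blinfun_apply R) \<and>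
     blinfun_apply R \<circ> blinfun_apply R = adjoint (blinfun_apply T) \<circ> blinfun_apply T)"

definition trace_norm :: "(L2 \<Rightarrow>\<^sub>L L2) \<Rightarrow> ennreal" where
  "trace_norm T = (\<Sum>n. ennreal (Re (cinner (fock n) (blinfun_apply (abs_op T) (fock n)))))"

text \<open>
  Every limit point of trace-class operators in trace norm is trace-class, so no separate condition
  is needed for that; complex linearity is required because \<open>trace_norm\<close> is the trace norm only
  for complex-linear operators.
\<close>

definition cch :: "(L2 \<Rightarrow>\<^sub>L L2) set \<Rightarrow> (L2 \<Rightarrow>\<^sub>L L2) set" where
  "cch S = {T. clinear (blinfun_apply T) \<and> (\<forall>e>0. \<exists>R\<in>convex hull S. trace_norm (T - R) < ennreal e)}"

lift_definition rank_one_projector :: "L2 \<Rightarrow> (L2 \<Rightarrow>\<^sub>L L2)" is "\<lambda>\<psi> \<phi>. cinner \<psi> \<phi> *\<^sub>C \<psi>"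
proof -
  fix \<psi> :: L2
  show "bounded_linear (\<lambda>\<phi>. cinner \<psi> \<phi> *\<^sub>C \<psi>)"
  proof (rule bounded_linear_intro[where K = "norm \<psi> * norm \<psi>"])
    fix \<phi> \<xi> :: L2 and r :: real
    show "cinner \<psi> (\<phi> + \<xi>) *\<^sub>C \<psi> = cinner \<psi> \<phi> *\<^sub>C \<psi> + cinner \<psi> \<xi> *\<^sub>C \<psi>"
      by (simp add: cinner_add_right cscale_add_left)
    show "cinner \<psi> (r *\<^sub>R \<phi>) *\<^sub>C \<psi> = r *\<^sub>R (cinner \<psi> \<phi> *\<^sub>C \<psi>)"
      by (simp add: scaleR_L2_def cinner_cscale_right cscale_cscale)
    show "norm (cinner \<psi> \<phi> *\<^sub>C \<psi>) \<le> norm \<phi> * (norm \<psi> * norm \<psi>)"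
      using mult_right_mono[OF norm_cinner_le[of \<psi> \<phi>] norm_ge_zero[of \<psi>]]
      by (simp add: norm_cscale mult_ac)
  qed
qed

definition stellar_set :: "nat \<Rightarrow> real \<Rightarrow> (L2 \<Rightarrow>\<^sub>L L2) set" where
  "stellar_set r E = cch {rank_one_projector \<psi> | \<psi>.
     norm \<psi> = 1 \<and> energy \<psi> \<le> ennreal E \<and> stellar_rank \<psi> \<le> enat r}"

lift_definition position_projector :: "real set \<Rightarrow> L2 \<Rightarrow> L2"
  is "\<lambda>A f x. if A \<in> sets borel then indicator A x * f x else 0"
proof -
  fix A :: "real set" and f g assume *: "L2_rel f g"
  have sq: "square_integrable (\<lambda>x. indicator A x * h x)"
    if "square_integrable h" "A \<in> sets borel" for h
  proof -
    have [measurable]: "h \<in> borel_measurable borel" "A \<in> sets borel"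
      using that by (auto simp: square_integrable_def)
    have "integrable lborel (\<lambda>x. (cmod (h x))\<^sup>2)" using that by (simp add: square_integrable_def)
    then have "integrable lborel (\<lambda>x. (cmod (indicator A x * h x))\<^sup>2)"
      by (rule Bochner_Integration.integrable_bound) (auto simp: indicator_def)
    then show ?thesis by (simp add: square_integrable_def)
  qed
  show "L2_rel (\<lambda>x. if A \<in> sets borel then indicator A x * f x else 0)
               (\<lambda>x. if A \<in> sets borel then indicator A x * g x else 0)"
    using * by (cases "A \<in> sets borel") (auto simp: L2_rel_def square_integrable_zero intro: sq)
qed

text \<open>The unitary \<open>exp (i \<theta> n)\<close>, diagonal in the Fock basis.\<close>

definition phase_rotation :: "real \<Rightarrow> L2 \<Rightarrow> L2" where
  "phase_rotation \<theta> \<psi> = (\<Sum>n. (cis (\<theta> * real n) * cinner (fock n) \<psi>) *\<^sub>C fock n)"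

text \<open>
  The spectral projector of \<open>q\<^sub>\<theta> = exp (- i \<theta> n) x exp (i \<theta> n)\<close> for a Borel set \<open>A\<close>, that is,
  \<open>\<integral>\<^sub>A |q\<rangle>\<langle>q| dq\<close> with the generalised eigenvectors \<open>exp (- i \<theta> n)|q\<rangle>\<close> of \<open>q\<^sub>\<theta>\<close>. By covariance of the
  functional calculus it is \<open>exp (- i \<theta> n) 1\<^sub>A(x) exp (i \<theta> n)\<close>. For \<open>a = (x + ip)/\<surd>2\<close> this \<open>q\<^sub>\<theta>\<close> equals
  \<open>x cos \<theta> - p sin \<theta>\<close>; the family with the opposite sign of \<open>p\<close> is the same one with \<open>\<theta>\<close> replaced
  by \<open>2\<pi> - \<theta>\<close>.
\<close>

definition quadrature_projector :: "real \<Rightarrow> real set \<Rightarrow> L2 \<Rightarrow> L2" where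
  "quadrature_projector \<theta> A = phase_rotation (- \<theta>) \<circ> position_projector A \<circ> phase_rotation \<theta>"

definition witness :: "real \<Rightarrow> real \<Rightarrow> real \<Rightarrow> L2 \<Rightarrow> L2" where
  "witness \<theta> x \<eta> = quadrature_projector \<theta> {x - \<eta>/2 .. x + \<eta>/2}"

definition quadrature_prob :: "real \<Rightarrow> (L2 \<Rightarrow>\<^sub>L L2) \<Rightarrow> real set \<Rightarrow> real" where
  "quadrature_prob \<theta> \<sigma> A = Re (op_trace (blinfun_apply \<sigma> \<circ> quadrature_projector \<theta> A))"

text \<open>
  The infimum is taken in the extended reals, where it needs no boundedness side condition.
\<close>

definition witness_threshold :: "real \<Rightarrow> real \<Rightarrow> real \<Rightarrow> real \<Rightarrow> ereal" where
  "witness_threshold \<theta> x \<eta> E =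
     (INF \<tau>\<in>stellar_set 0 E. ereal (Re (op_trace (blinfun_apply \<tau> \<circ> witness \<theta> x \<eta>))))"

end

theory Submission
  imports Defs
begin

text \<open>
  Since \<open>\<sigma>\<close> itself competes in the infimum defining the threshold, the probability of an outcome
  in the interval is at least the threshold. So failure forces the empirical frequency to fall
  more than \<open>\<epsilon>\<close> below its mean, and Hoeffding's inequality applies.
\<close>

text \<open>The indicators of the events \<open>X i\<close> in \<open>A\<close> are independent, lie
  between 0 and 1 and have mean \<open>p\<close>, so Hoeffding's lower-tail bound applies to their
  sum. Only the law of \<open>X i\<close> on the single set \<open>A\<close> enters.\<close>

lemma (in prob_space) Hoeffding_frequency_le:
  fixes X :: "'i \<Rightarrow> 'a \<Rightarrow> 'b :: topological_space"
  assumes I: "finite I" "I \<noteq> {}"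
    and indep: "indep_vars (\<lambda>_. borel) X I"
    and A: "A \<in> sets borel"
    and p: "\<And>i. i \<in> I \<Longrightarrow> prob {\<omega> \<in> space M. X i \<omega> \<in> A} = p"
    and \<epsilon>: "0 \<le> \<epsilon>"
  shows "prob {\<omega> \<in> space M. (\<Sum>i\<in>I. indicator A (X i \<omega>)) / real (card I) \<le> p - \<epsilon>}
           \<le> exp (- 2 * real (card I) * \<epsilon>\<^sup>2)"
proof -
  let ?Y = "\<lambda>i \<omega>. indicator A (X i \<omega>) :: real"
  let ?n = "real (card I)"
  have n: "0 < ?n"
    using I by (simp add: card_gt_0_iff)
  have expectation: "expectation (?Y i) = p" if i: "i \<in> I" for i
  proof -
    have [measurable]: "random_variable borel (X i)"
      using indep i by (auto simp: indep_vars_def)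
    \<comment> \<open>The two integrands agree on \<open>space M\<close>, which suffices for the
      integrals.\<close>
    have "expectation (?Y i) = expectation (indicator {\<omega> \<in> space M. X i \<omega> \<in> A})"
      by (intro Bochner_Integration.integral_cong) (auto simp: indicator_def)
    also have "\<dots> = prob {\<omega> \<in> space M. X i \<omega> \<in> A}"
      using A by simp
    finally show ?thesis
      using p[OF i] by simp
  qed
  interpret Hoeffding_ineq M I ?Y "\<lambda>_. 0" "\<lambda>_. 1" "\<Sum>i\<in>I. expectation (?Y i)"
  proof unfold_locales
    show "indep_vars (\<lambda>_. borel) ?Y I"
      using A by (intro indep_vars_compose2[OF indep]) auto
  qed (use I in \<open>auto simp: indicator_def\<close>)
  \<comment> \<open>A deviation of \<epsilon> in the frequency is one of
    \<open>?n * \<epsilon>\<close> in the sum.\<close>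
  have "prob {\<omega> \<in> space M. (\<Sum>i\<in>I. ?Y i \<omega>) \<le> (\<Sum>i\<in>I. expectation (?Y i)) - ?n * \<epsilon>}
          \<le> exp (- 2 * (?n * \<epsilon>)\<^sup>2 / (\<Sum>i\<in>I. (1 - 0)\<^sup>2))"
    using n \<epsilon> by (intro Hoeffding_ineq_le) auto
  \<comment> \<open>The squared ranges add up to \<open>?n\<close>, cancelling one of the two
    factors \<open>?n\<close> above.\<close>
  also have "- 2 * (?n * \<epsilon>)\<^sup>2 / (\<Sum>i\<in>I. (1 - 0)\<^sup>2) = - 2 * ?n * \<epsilon>\<^sup>2"
    using n by (simp add: power2_eq_square)
  finally show ?thesis
    using n by (simp add: expectation field_simps)
qed

theorem theorem8:
  fixes \<theta> x \<eta> E \<epsilon> :: real and M :: nat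
    and \<sigma> :: "L2 \<Rightarrow>\<^sub>L L2"
    and P :: "'s measure" and q :: "nat \<Rightarrow> 's \<Rightarrow> real"
  assumes "0 \<le> \<theta>" "\<theta> < 2 * pi" "0 < \<eta>" "0 \<le> E" "1 \<le> M" "0 < \<epsilon>"
    and "\<sigma> \<in> stellar_set 0 E"
    and "prob_space P"
    and "prob_space.indep_vars P (\<lambda>_. borel) q {1..M}"
    and "\<forall>j\<in>{1..M}. \<forall>A\<in>sets borel.
           measure P {\<omega> \<in> space P. q j \<omega> \<in> A} = quadrature_prob \<theta> \<sigma> A"
  shows "measure P {\<omega> \<in> space P.
             ereal ((\<Sum>j=1..M. indicator {x - \<eta>/2 .. x + \<eta>/2} (q j \<omega>)) / real M)
               < witness_threshold \<theta> x \<eta> E - ereal \<epsilon>}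
         \<le> exp (- 2 * real M * \<epsilon>\<^sup>2)"
proof -
  interpret prob_space P by fact
  let ?A = "{x - \<eta>/2 .. x + \<eta>/2}"
  let ?m = "\<lambda>\<omega>. (\<Sum>j=1..M. indicator ?A (q j \<omega>)) / real M"
  define p where "p = quadrature_prob \<theta> \<sigma> ?A"
  \<comment> \<open>Once unfolded, \<open>p\<close> is the value at \<sigma> of the very functional
    whose infimum is taken.\<close>
  have "witness_threshold \<theta> x \<eta> E \<le> ereal p"
    unfolding witness_threshold_def p_def quadrature_prob_def witness_def
    by (rule INF_lower) fact
  then have threshold: "witness_threshold \<theta> x \<eta> E - ereal \<epsilon> \<le> ereal (p - \<epsilon>)"
    using ereal_minus_mono[of "witness_threshold \<theta> x \<eta> E" "ereal p" "ereal \<epsilon>" "ereal \<epsilon>"] by simp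
  have [measurable]: "random_variable borel (q j)" if "j \<in> {1..M}" for j
    using that \<open>indep_vars (\<lambda>_. borel) q {1..M}\<close> by (auto simp: indep_vars_def)
  \<comment> \<open>Pass from the strict extended-real event to a larger, measurable event stated in
    the reals, in the form bounded by Hoeffding.\<close>
  have "measure P {\<omega> \<in> space P. ereal (?m \<omega>) < witness_threshold \<theta> x \<eta> E - ereal \<epsilon>}
          \<le> measure P {\<omega> \<in> space P. ?m \<omega> \<le> p - \<epsilon>}"
  proof (rule finite_measure_mono)
    show "{\<omega> \<in> space P. ereal (?m \<omega>) < witness_threshold \<theta> x \<eta> E - ereal \<epsilon>}
            \<subseteq> {\<omega> \<in> space P. ?m \<omega> \<le> p - \<epsilon>}"
      using threshold by (auto dest: less_le_trans)
    show "{\<omega> \<in> space P. ?m \<omega> \<le> p - \<epsilon>} \<in> events"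
      by measurable
  qed
  also have "\<dots> \<le> exp (- 2 * real M * \<epsilon>\<^sup>2)"
  proof -
    \<comment> \<open>The Born rule assumed for each outcome, taken at the closed, hence Borel,
      interval.\<close>
    have "measure P {\<omega> \<in> space P. q j \<omega> \<in> ?A} = p" if "j \<in> {1..M}" for j
      unfolding p_def by (rule assms(10)[rule_format, OF that borel_closed[OF closed_atLeastAtMost]])
    from Hoeffding_frequency_le[OF _ _ assms(9) _ this, of \<epsilon>] show ?thesis
      using \<open>1 \<le> M\<close> \<open>0 < \<epsilon>\<close> by simp
  qed
  finally show ?thesis .
qed

end
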